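(* Let $n,m,k\in\mathbf{N}$ with $m$ and $k$ even and $m\ge k$. Then the following are equivalent: (i) for all $n\times n$ Hermitian matrices $A$ and $B$, we have $\mathrm{Tr}(S_{m,k}(A,B))\ge 0$; (ii) for all $n\times n$ Hermitian matrices $A$ and $B$, either $S_{m,k}(A,B)=0$ or $S_{m,k}(A,B)$ has a strictly positive eigenvalue.
   Context: $\mathbf{N}$ denotes the positive integers. Matrices are complex. $S_{m,k}(A,B)$ denotes the sum of all words of length $m$ in the noncommuting letters $A$ and $B$ having exactly $k$ letters equal to $B$ and $m-k$ letters equal to $A$ (evaluated at the given matrices). If $A$ and $B$ are Hermitian matrices, then $S_{m,k}(A,B)$ is Hermitian. $\mathrm{Tr}$ is the usual trace. *)

theory Defs
  imports "Jordan_Normal_Form.Schur_Decomposition" "Jordan_Normal_Form.Char_Poly"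
begin

definition hermitian_mats :: "nat \<Rightarrow> complex mat set" where
  "hermitian_mats n = {A \<in> carrier_mat n n. mat_adjoint A = A}"

(* For complex matrices, 0 <= mat_trace A refers to the order of Complex_Order:
   the trace is real and nonnegative. *)
definition mat_trace :: "'a::comm_monoid_add mat \<Rightarrow> 'a" where
  "mat_trace A = (\<Sum>i<dim_row A. A $$ (i, i))"

datatype letter = LetA | LetB

definition words :: "nat \<Rightarrow> nat \<Rightarrow> letter list set" where
  "words m k = {w. length w = m \<and> count_list w LetB = k}"

fun word_eval :: "complex mat \<Rightarrow> complex mat \<Rightarrow> letter list \<Rightarrow> complex mat" where
  "word_eval A B [] = 1\<^sub>m (dim_row A)"
| "word_eval A B (LetA # w) = A * word_eval A B w"
| "word_eval A B (LetB # w) = B * word_eval A B w"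

(* The sum is taken entrywise because matrices of unspecified dimension do not
   form an additive monoid, so the type-class sum is unavailable for them. *)
definition S_mat :: "nat \<Rightarrow> nat \<Rightarrow> complex mat \<Rightarrow> complex mat \<Rightarrow> complex mat" where
  "S_mat m k A B =
     mat (dim_row A) (dim_row A) (\<lambda>ij. \<Sum>w\<in>words m k. word_eval A B w $$ ij)"

end

theory Submission
  imports Defs "HOL-Analysis.Function_Topology" "HOL-Analysis.Derivative"
begin

text \<open>
  Write $S = S_{m,k}(A,B)$, a Hermitian matrix.

  If the trace of $S$ is nonnegative but $S$ has no positive eigenvalue, then its eigenvalues are
  nonpositive reals with nonnegative sum, so they all vanish; hence the trace of $S^2$, which is the
  squared Frobenius norm of $S$, vanishes and $S = 0$.

  For the converse, suppose that some Hermitian pair gives a negative trace, and minimise the trace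
  of $S_{m,k}(A,B)$ over the compact set of Hermitian pairs with both Frobenius norms equal to $1$.
  The minimum $c$ is negative, because $S_{m,k}$ is homogeneous in each argument.
  At a minimiser $(A,B)$ the Euler--Lagrange equations read
  $S_{m-1,k}(A,B) = \alpha A$ and $S_{m-1,k-1}(A,B) = \beta B$ with
  $\alpha = c(m-k)/m$ and $\beta = ck/m$ (\<open>word_sum_critical_point\<close>).
  Splitting off the first letter of each word,
  $S_{m,k}(A,B) = A S_{m-1,k}(A,B) + B S_{m-1,k-1}(A,B) = \alpha A^2 + \beta B^2$.
  As $\alpha, \beta \le 0$, this matrix is negative semidefinite, and it is not $0$ because its trace
  is $c$. So it is nonzero and has no positive eigenvalue.

  The Euler--Lagrange equations rest on the derivative of the trace in a direction $(X,Y)$, which is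
  $m$ times the trace of $S_{m-1,k}(A,B) X + S_{m-1,k-1}(A,B) Y$ (\<open>word_sum_trace_derivative\<close>).
  It is obtained without counting words: $(A + sB)^m$ is the generating function of the word sums,
  the derivative of the trace of an $m$-th power $M^m$ is the trace of $m M^{m-1} M'$, and
  coefficients of $s$ are compared.
\<close>

section \<open>Entries, traces and Hermitian matrices\<close>

lemma mult_entry:
  assumes "A \<in> carrier_mat n n" "B \<in> carrier_mat n n" "i < n" "j < n"
  shows "(A * B) $$ (i, j) = (\<Sum>l<n. A $$ (i, l) * B $$ (l, j))"
  using assms by (simp add: scalar_prod_def atLeast0LessThan)

lemma mat_trace_carrier:
  "A \<in> carrier_mat n n \<Longrightarrow> mat_trace A = (\<Sum>i<n. A $$ (i, i))"
  by (auto simp: mat_trace_def)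

lemma mat_trace_mult:
  fixes A B :: "'a::semiring_0 mat"
  assumes "A \<in> carrier_mat n n" "B \<in> carrier_mat n n"
  shows "mat_trace (A * B) = (\<Sum>i<n. \<Sum>j<n. A $$ (i, j) * B $$ (j, i))"
proof -
  have "A * B \<in> carrier_mat n n" using assms by simp
  from mat_trace_carrier[OF this] show ?thesis
    by (simp add: mult_entry[OF assms] del: index_mult_mat)
qed

lemma mat_trace_mult_commute:
  fixes A B :: "'a::comm_semiring_0 mat"
  assumes "A \<in> carrier_mat n n" "B \<in> carrier_mat n n"
  shows "mat_trace (A * B) = mat_trace (B * A)"
  unfolding mat_trace_mult[OF assms] mat_trace_mult[OF assms(2,1)]
  by (subst sum.swap) (simp add: mult.commute)

lemma mat_trace_add:
  assumes "A \<in> carrier_mat n n" "B \<in> carrier_mat n n"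
  shows "mat_trace (A + B) = mat_trace A + mat_trace B"
  using assms by (simp add: mat_trace_def sum.distrib)

lemma mat_trace_smult:
  fixes A :: "'a::semiring_0 mat"
  assumes "A \<in> carrier_mat n n"
  shows "mat_trace (c \<cdot>\<^sub>m A) = c * mat_trace A"
  using assms by (simp add: mat_trace_def sum_distrib_left)

lemma mat_adjoint_entry:
  assumes "A \<in> carrier_mat n n" "i < n" "j < n"
  shows "mat_adjoint A $$ (i, j) = cnj (A $$ (j, i))"
  using assms by (simp add: mat_adjoint_def mat_of_rows_def)

lemma mat_adjoint_carrier:
  "A \<in> carrier_mat n n \<Longrightarrow> mat_adjoint A \<in> carrier_mat n n"
  by (auto simp: mat_adjoint_def)

lemma hermitian_mats_carrier: "A \<in> hermitian_mats n \<Longrightarrow> A \<in> carrier_mat n n"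
  by (simp add: hermitian_mats_def)

lemma hermitian_mats_entry:
  assumes "A \<in> hermitian_mats n" "i < n" "j < n"
  shows "A $$ (i, j) = cnj (A $$ (j, i))"
  using assms mat_adjoint_entry[of A n i j] by (simp add: hermitian_mats_def)

lemma hermitian_matsI:
  assumes "A \<in> carrier_mat n n"
    and "\<And>i j. i < n \<Longrightarrow> j < n \<Longrightarrow> cnj (A $$ (j, i)) = A $$ (i, j)"
  shows "A \<in> hermitian_mats n"
proof -
  have "mat_adjoint A = A"
    by (rule eq_matI) (use assms mat_adjoint_carrier[OF assms(1)] in \<open>auto simp: mat_adjoint_entry\<close>)
  then show ?thesis using assms by (simp add: hermitian_mats_def)
qed

lemma hermitian_mats_add:
  assumes "A \<in> hermitian_mats n" "B \<in> hermitian_mats n"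
  shows "A + B \<in> hermitian_mats n"
proof (rule hermitian_matsI)
  fix i j assume "i < n" "j < n"
  then show "cnj ((A + B) $$ (j, i)) = (A + B) $$ (i, j)"
    using hermitian_mats_carrier[OF assms(1)] hermitian_mats_carrier[OF assms(2)]
      hermitian_mats_entry[OF assms(1), of i j] hermitian_mats_entry[OF assms(2), of i j]
    by simp
qed (use assms hermitian_mats_carrier in auto)

lemma hermitian_mats_smult:
  assumes "A \<in> hermitian_mats n"
  shows "complex_of_real r \<cdot>\<^sub>m A \<in> hermitian_mats n"
proof (rule hermitian_matsI)
  fix i j assume "i < n" "j < n"
  then show "cnj ((complex_of_real r \<cdot>\<^sub>m A) $$ (j, i)) = (complex_of_real r \<cdot>\<^sub>m A) $$ (i, j)"
    using hermitian_mats_carrier[OF assms] hermitian_mats_entry[OF assms, of i j] by simp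
qed (use assms hermitian_mats_carrier in auto)

lemma one_mat_hermitian: "1\<^sub>m n \<in> hermitian_mats n"
  by (rule hermitian_matsI) auto

text \<open>
  On Hermitian matrices this is the real Frobenius inner product.
\<close>

definition trace_inner :: "complex mat \<Rightarrow> complex mat \<Rightarrow> real" where
  "trace_inner A B = Re (mat_trace (A * B))"

lemma trace_inner_self:
  assumes "A \<in> hermitian_mats n"
  shows "trace_inner A A = (\<Sum>i<n. \<Sum>j<n. (cmod (A $$ (i, j)))\<^sup>2)"
proof -
  note A = hermitian_mats_carrier[OF assms]
  have "Re (A $$ (i, j) * A $$ (j, i)) = (cmod (A $$ (i, j)))\<^sup>2" if "i < n" "j < n" for i j
  proof -
    have "A $$ (j, i) = cnj (A $$ (i, j))" using hermitian_mats_entry[OF assms] that by blast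
    then show ?thesis by (simp add: cmod_power2 flip: power2_eq_square)
  qed
  then show ?thesis unfolding trace_inner_def mat_trace_mult[OF A A] by (simp del: times_complex.simps)
qed

lemma trace_inner_self_nonneg:
  "A \<in> hermitian_mats n \<Longrightarrow> 0 \<le> trace_inner A A"
  by (simp add: trace_inner_self sum_nonneg)

lemma trace_inner_self_eq_0:
  assumes "A \<in> hermitian_mats n" "trace_inner A A = 0"
  shows "A = 0\<^sub>m n n"
proof -
  have "\<forall>i\<in>{..<n}. (\<Sum>j<n. (cmod (A $$ (i, j)))\<^sup>2) = 0"
    using assms by (subst sum_nonneg_eq_0_iff[symmetric]) (auto simp: trace_inner_self intro: sum_nonneg)
  then have "\<forall>i<n. \<forall>j<n. A $$ (i, j) = 0"
    by (auto simp: sum_nonneg_eq_0_iff)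
  then show ?thesis using hermitian_mats_carrier[OF assms(1)] by (auto intro!: eq_matI)
qed

lemma trace_inner_commute:
  "A \<in> carrier_mat n n \<Longrightarrow> B \<in> carrier_mat n n \<Longrightarrow> trace_inner A B = trace_inner B A"
  unfolding trace_inner_def by (subst mat_trace_mult_commute) auto

lemma trace_inner_add_right:
  assumes "A \<in> carrier_mat n n" "B \<in> carrier_mat n n" "C \<in> carrier_mat n n"
  shows "trace_inner A (B + C) = trace_inner A B + trace_inner A C"
  using assms unfolding trace_inner_def
  by (simp add: mult_add_distrib_mat[of _ n n _ n] mat_trace_add[of _ n])

lemma trace_inner_smult_right:
  assumes "A \<in> carrier_mat n n" "B \<in> carrier_mat n n"
  shows "trace_inner A (complex_of_real r \<cdot>\<^sub>m B) = r * trace_inner A B"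
  using assms unfolding trace_inner_def
  by (simp add: mult_smult_distrib[of _ n n _ n] mat_trace_smult[of _ n])

lemma trace_inner_line:
  assumes "A \<in> carrier_mat n n" "X \<in> carrier_mat n n"
  shows "trace_inner (A + complex_of_real t \<cdot>\<^sub>m X) (A + complex_of_real t \<cdot>\<^sub>m X) =
    trace_inner A A + 2 * t * trace_inner A X + t\<^sup>2 * trace_inner X X"
proof -
  let ?tX = "complex_of_real t \<cdot>\<^sub>m X"
  have tX: "?tX \<in> carrier_mat n n" "A + ?tX \<in> carrier_mat n n" using assms by auto
  have "trace_inner (A + ?tX) (A + ?tX) = trace_inner A (A + ?tX) + t * trace_inner X (A + ?tX)"
    using assms tX
    by (subst trace_inner_add_right[of _ n])
       (simp_all add: trace_inner_smult_right[of _ n] trace_inner_commute[of "A + ?tX" n])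
  also have "\<dots> = trace_inner A A + 2 * t * trace_inner A X + t\<^sup>2 * trace_inner X X"
    using assms tX
    by (simp add: trace_inner_add_right[of _ n] trace_inner_smult_right[of _ n] trace_inner_commute[of X n A]
        algebra_simps power2_eq_square)
  finally show ?thesis .
qed

section \<open>Word sums\<close>

lemma finite_words: "finite (words m k)"
proof -
  have "(UNIV :: letter set) = {LetA, LetB}" using letter.exhaust by auto
  then have "finite (UNIV :: letter set)" by (metis finite.emptyI finite.insertI)
  then have "finite {w :: letter list. set w \<subseteq> UNIV \<and> length w = m}"
    by (rule finite_lists_length_eq)
  then show ?thesis by (rule rev_finite_subset) (auto simp: words_def)
qed

lemma words_Suc_Suc:
  "words (Suc m) (Suc k) = Cons LetA ` words m (Suc k) \<union> Cons LetB ` words m k"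
proof (intro Set.set_eqI iffI)
  fix w assume w: "w \<in> words (Suc m) (Suc k)"
  then obtain a v where "w = a # v" by (cases w) (auto simp: words_def)
  with w show "w \<in> Cons LetA ` words m (Suc k) \<union> Cons LetB ` words m k"
    by (cases a) (auto simp: words_def)
qed (auto simp: words_def)

lemma words_Suc_0: "words (Suc m) 0 = Cons LetA ` words m 0"
proof (intro Set.set_eqI iffI)
  fix w assume w: "w \<in> words (Suc m) 0"
  then obtain a v where "w = a # v" by (cases w) (auto simp: words_def)
  with w show "w \<in> Cons LetA ` words m 0"
    by (cases a) (auto simp: words_def)
qed (auto simp: words_def)

lemma words_empty: "m < k \<Longrightarrow> words m k = {}"
  unfolding words_def using count_le_length[of _ LetB] by (auto simp: not_le[symmetric])

lemma words_0_0: "words 0 0 = {[]}"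
  by (auto simp: words_def)

lemma word_eval_carrier:
  assumes "A \<in> carrier_mat n n" "B \<in> carrier_mat n n"
  shows "word_eval A B w \<in> carrier_mat n n"
  using assms by (induction A B w rule: word_eval.induct) auto

lemma S_mat_carrier: "A \<in> carrier_mat n n \<Longrightarrow> S_mat m k A B \<in> carrier_mat n n"
  by (auto simp: S_mat_def)

lemma S_mat_entry:
  assumes "A \<in> carrier_mat n n" "i < n" "j < n"
  shows "S_mat m k A B $$ (i, j) = (\<Sum>w\<in>words m k. word_eval A B w $$ (i, j))"
  using assms by (auto simp: S_mat_def)

lemma S_mat_empty: "A \<in> carrier_mat n n \<Longrightarrow> m < k \<Longrightarrow> S_mat m k A B = 0\<^sub>m n n"
  by (auto simp: S_mat_def words_empty intro!: eq_matI)

lemma mult_S_mat_entry: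
  assumes "A \<in> carrier_mat n n" "B \<in> carrier_mat n n" "C \<in> carrier_mat n n" "i < n" "j < n"
  shows "(C * S_mat m k A B) $$ (i, j) = (\<Sum>w\<in>words m k. (C * word_eval A B w) $$ (i, j))"
proof -
  have "(C * S_mat m k A B) $$ (i, j) =
      (\<Sum>l<n. \<Sum>w\<in>words m k. C $$ (i, l) * word_eval A B w $$ (l, j))"
    unfolding mult_entry[OF assms(3) S_mat_carrier[OF assms(1)] assms(4,5)]
    using assms by (simp add: S_mat_entry sum_distrib_left)
  also have "\<dots> = (\<Sum>w\<in>words m k. \<Sum>l<n. C $$ (i, l) * word_eval A B w $$ (l, j))"
    by (rule sum.swap)
  finally show ?thesis using assms
    by (simp add: mult_entry[OF assms(3) word_eval_carrier[OF assms(1,2)] assms(4,5)] del: index_mult_mat)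
qed

lemma S_mat_Suc_Suc:
  assumes A: "A \<in> carrier_mat n n" and B: "B \<in> carrier_mat n n"
  shows "S_mat (Suc m) (Suc k) A B = A * S_mat m (Suc k) A B + B * S_mat m k A B"
proof (rule eq_matI)
  note c = S_mat_carrier[OF A]
  fix i j
  assume "i < dim_row (A * S_mat m (Suc k) A B + B * S_mat m k A B)"
    "j < dim_col (A * S_mat m (Suc k) A B + B * S_mat m k A B)"
  then have ij: "i < n" "j < n" using A B c[of m k B] by auto
  have "S_mat (Suc m) (Suc k) A B $$ (i, j) =
     (\<Sum>w\<in>words m (Suc k). (A * word_eval A B w) $$ (i, j)) +
     (\<Sum>w\<in>words m k. (B * word_eval A B w) $$ (i, j))"
    unfolding S_mat_entry[OF A ij] words_Suc_Suc
    by (subst sum.union_disjoint) (auto simp: finite_words sum.reindex)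
  also have "\<dots> = (A * S_mat m (Suc k) A B) $$ (i, j) + (B * S_mat m k A B) $$ (i, j)"
    by (simp only: mult_S_mat_entry[OF A B A ij] mult_S_mat_entry[OF A B B ij])
  also have "\<dots> = (A * S_mat m (Suc k) A B + B * S_mat m k A B) $$ (i, j)"
    using A B c[of m k B] ij by (subst index_add_mat(1)) auto
  finally show "S_mat (Suc m) (Suc k) A B $$ (i, j) =
      (A * S_mat m (Suc k) A B + B * S_mat m k A B) $$ (i, j)" .
qed (use A B in \<open>auto simp: S_mat_def\<close>)

lemma S_mat_Suc_0:
  assumes A: "A \<in> carrier_mat n n" and B: "B \<in> carrier_mat n n"
  shows "S_mat (Suc m) 0 A B = A * S_mat m 0 A B"
proof (rule eq_matI)
  note c = S_mat_carrier[OF A]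
  fix i j
  assume "i < dim_row (A * S_mat m 0 A B)" "j < dim_col (A * S_mat m 0 A B)"
  then have ij: "i < n" "j < n" using A B c[of m 0 B] by auto
  show "S_mat (Suc m) 0 A B $$ (i, j) = (A * S_mat m 0 A B) $$ (i, j)"
    unfolding S_mat_entry[OF A ij] words_Suc_0 mult_S_mat_entry[OF A B A ij]
    by (auto simp: finite_words sum.reindex)
qed (use A B in \<open>auto simp: S_mat_def\<close>)

lemma S_mat_0_0: "A \<in> carrier_mat n n \<Longrightarrow> S_mat 0 0 A B = 1\<^sub>m n"
  by (auto simp: S_mat_def words_0_0 intro!: eq_matI)

lemma word_eval_append:
  assumes A: "A \<in> carrier_mat n n" and B: "B \<in> carrier_mat n n"
  shows "word_eval A B (u @ v) = word_eval A B u * word_eval A B v"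
proof (induction u)
  case (Cons a u)
  then show ?case using word_eval_carrier[OF A B] A B
    by (cases a) (simp_all add: assoc_mult_mat[of _ n n _ n _ n])
qed (use word_eval_carrier[OF A B, of v] A in \<open>simp add: left_mult_one_mat\<close>)

text \<open>
  The adjoint of a product is the product of the adjoints in reverse order. The adjoint is written out
  in entries, which is the form that the sum over all words needs.
\<close>

lemma word_eval_rev_entry:
  assumes A: "A \<in> hermitian_mats n" and B: "B \<in> hermitian_mats n"
  shows "i < n \<Longrightarrow> j < n \<Longrightarrow> word_eval A B (rev w) $$ (i, j) = cnj (word_eval A B w $$ (j, i))"
proof (induction w arbitrary: i j)
  case Nil
  then show ?case using hermitian_mats_carrier[OF A] by simp
next
  case (Cons a w)
  note cA = hermitian_mats_carrier[OF A] and cB = hermitian_mats_carrier[OF B]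
  define M where "M = (case a of LetA \<Rightarrow> A | LetB \<Rightarrow> B)"
  have hM: "M \<in> hermitian_mats n" using A B by (cases a) (simp_all add: M_def)
  note M = hermitian_mats_carrier[OF hM]
  have "word_eval A B [a] = M" using cA cB by (cases a) (auto simp: M_def)
  then have "word_eval A B (rev (a # w)) $$ (i, j) = (word_eval A B (rev w) * M) $$ (i, j)"
    by (simp add: word_eval_append[OF cA cB])
  also have "\<dots> = (\<Sum>l<n. word_eval A B (rev w) $$ (i, l) * M $$ (l, j))"
    by (rule mult_entry[OF word_eval_carrier[OF cA cB] M Cons.prems])
  also have "\<dots> = (\<Sum>l<n. cnj (word_eval A B w $$ (l, i)) * cnj (M $$ (j, l)))"
    using Cons(2,3)
    by (intro sum.cong refl) (simp add: Cons(1) hermitian_mats_entry[OF hM, of _ j])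
  also have "\<dots> = cnj ((M * word_eval A B w) $$ (j, i))"
    by (subst mult_entry[OF M word_eval_carrier[OF cA cB] Cons.prems(2,1)])
       (simp add: mult.commute)
  also have "M * word_eval A B w = word_eval A B (a # w)" by (cases a) (simp_all add: M_def)
  finally show ?case .
qed

text \<open>
  Reversal permutes the words with a given number of each letter, so taking adjoints only permutes
  the summands.
\<close>

lemma S_mat_hermitian:
  assumes A: "A \<in> hermitian_mats n" and B: "B \<in> hermitian_mats n"
  shows "S_mat m k A B \<in> hermitian_mats n"
proof -
  note cA = hermitian_mats_carrier[OF A]
  have bij: "bij_betw rev (words m k) (words m k)"
    by (rule bij_betwI[of _ _ _ rev]) (auto simp: words_def)
  have "S_mat m k A B $$ (i, j) = cnj (S_mat m k A B $$ (j, i))" if ij: "i < n" "j < n" for i j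
  proof -
    have "S_mat m k A B $$ (i, j) = (\<Sum>w\<in>words m k. word_eval A B (rev w) $$ (i, j))"
      unfolding S_mat_entry[OF cA ij] by (rule sum.reindex_bij_betw[OF bij, symmetric])
    then show ?thesis
      by (simp add: word_eval_rev_entry[OF A B ij] S_mat_entry[OF cA ij(2,1)])
  qed
  then show ?thesis by (intro hermitian_matsI S_mat_carrier[OF cA]) (rule sym)
qed

lemma smult_smult_mat: "a \<cdot>\<^sub>m (b \<cdot>\<^sub>m M) = (a * b) \<cdot>\<^sub>m (M :: 'a::semigroup_mult mat)"
  by (rule eq_matI) (simp_all add: mult.assoc)

lemma word_eval_smult:
  assumes A: "A \<in> carrier_mat n n" and B: "B \<in> carrier_mat n n"
  shows "word_eval (a \<cdot>\<^sub>m A) (b \<cdot>\<^sub>m B) w =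
    (a ^ count_list w LetA * b ^ count_list w LetB) \<cdot>\<^sub>m word_eval A B w"
proof (induction w)
  case Nil
  show ?case using A by (auto intro!: eq_matI)
next
  case (Cons x w)
  note c = word_eval_carrier[OF A B, of w]
  have step: "(x \<cdot>\<^sub>m M) * (y \<cdot>\<^sub>m word_eval A B w) = (x * y) \<cdot>\<^sub>m (M * word_eval A B w)"
    if "M \<in> carrier_mat n n" for x y M
    using that c
    by (simp add: mult_smult_assoc_mat[of _ n n _ n] mult_smult_distrib[of _ n n _ n] smult_smult_mat mult.commute)
  show ?case
    by (cases x) (simp_all only: Cons word_eval.simps step[OF A] step[OF B],
        simp_all add: mult.assoc mult.left_commute)
qed

lemma S_mat_smult:
  assumes A: "A \<in> carrier_mat n n" and B: "B \<in> carrier_mat n n"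
  shows "S_mat m k (a \<cdot>\<^sub>m A) (b \<cdot>\<^sub>m B) = (a ^ (m - k) * b ^ k) \<cdot>\<^sub>m S_mat m k A B"
proof (rule eq_matI)
  have count: "count_list w LetA + count_list w LetB = length w" for w
  proof (induction w)
    case (Cons x w)
    then show ?case by (cases x) auto
  qed simp
  fix i j assume "i < dim_row ((a ^ (m - k) * b ^ k) \<cdot>\<^sub>m S_mat m k A B)"
    "j < dim_col ((a ^ (m - k) * b ^ k) \<cdot>\<^sub>m S_mat m k A B)"
  then have ij: "i < n" "j < n" using S_mat_carrier[OF A, of m k B] by auto
  have aA: "a \<cdot>\<^sub>m A \<in> carrier_mat n n" using A by simp
  have *: "word_eval (a \<cdot>\<^sub>m A) (b \<cdot>\<^sub>m B) w $$ (i, j) = a ^ (m - k) * b ^ k * word_eval A B w $$ (i, j)"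
    if "w \<in> words m k" for w
  proof -
    have "count_list w LetB = k" "count_list w LetA = m - k"
      using that count[of w] by (auto simp: words_def)
    then show ?thesis using word_eval_carrier[OF A B, of w] ij by (simp add: word_eval_smult[OF A B])
  qed
  show "S_mat m k (a \<cdot>\<^sub>m A) (b \<cdot>\<^sub>m B) $$ (i, j) = ((a ^ (m - k) * b ^ k) \<cdot>\<^sub>m S_mat m k A B) $$ (i, j)"
    using S_mat_carrier[OF A, of m k B] ij
    by (simp add: S_mat_entry[OF aA ij] * S_mat_entry[OF A ij] sum_distrib_left)
qed (use A S_mat_carrier[OF A] in \<open>auto simp: S_mat_def\<close>)

section \<open>The derivative of the trace of a word sum\<close>

text \<open>
  The entries of a word are polynomials in the entries of the two matrices, so they inherit every
  property of scalar functions that constants have and that sums and products preserve. This serves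
  both for differentiability along a line and for continuity in all entries.
\<close>

lemma word_eval_entry_closed:
  fixes P :: "('x \<Rightarrow> complex) \<Rightarrow> bool"
  assumes const: "\<And>c. P (\<lambda>_. c)"
    and add: "\<And>f g. P f \<Longrightarrow> P g \<Longrightarrow> P (\<lambda>x. f x + g x)"
    and mult: "\<And>f g. P f \<Longrightarrow> P g \<Longrightarrow> P (\<lambda>x. f x * g x)"
    and A: "\<And>x. A x \<in> carrier_mat n n" "\<And>i j. i < n \<Longrightarrow> j < n \<Longrightarrow> P (\<lambda>x. A x $$ (i, j))"
    and B: "\<And>x. B x \<in> carrier_mat n n" "\<And>i j. i < n \<Longrightarrow> j < n \<Longrightarrow> P (\<lambda>x. B x $$ (i, j))"
  shows "i < n \<Longrightarrow> j < n \<Longrightarrow> P (\<lambda>x. word_eval (A x) (B x) w $$ (i, j))"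
proof (induction w arbitrary: i j)
  case Nil
  have "word_eval (A x) (B x) [] $$ (i, j) = (if i = j then 1 else 0)" for x
    using Nil A(1)[of x] by simp
  then show ?case by (simp only: const)
next
  case (Cons a w)
  have sum: "P (\<lambda>x. \<Sum>l<r. f l x)" if "\<And>l. l < r \<Longrightarrow> P (f l)" for f and r :: nat
    using that by (induction r) (simp_all add: const add)
  have c: "word_eval (A x) (B x) w \<in> carrier_mat n n" for x by (rule word_eval_carrier[OF A(1) B(1)])
  show ?case
  proof (cases a)
    case LetA
    then have "word_eval (A x) (B x) (a # w) $$ (i, j) =
        (\<Sum>l<n. A x $$ (i, l) * word_eval (A x) (B x) w $$ (l, j))" for x
      using mult_entry[OF A(1) c Cons.prems] by simp
    then show ?thesis using A(2) Cons by (simp only:) (intro sum mult; blast)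
  next
    case LetB
    then have "word_eval (A x) (B x) (a # w) $$ (i, j) =
        (\<Sum>l<n. B x $$ (i, l) * word_eval (A x) (B x) w $$ (l, j))" for x
      using mult_entry[OF B(1) c Cons.prems] by simp
    then show ?thesis using B(2) Cons by (simp only:) (intro sum mult; blast)
  qed
qed

lemma mat_trace_S_mat:
  assumes "A \<in> carrier_mat n n"
  shows "mat_trace (S_mat m k A B) = (\<Sum>i<n. \<Sum>w\<in>words m k. word_eval A B w $$ (i, i))"
  using assms by (simp add: mat_trace_carrier[OF S_mat_carrier[OF assms]] S_mat_entry)

lemma pow_mat_Suc_left:
  assumes "M \<in> carrier_mat n n"
  shows "M ^\<^sub>m Suc m = M * M ^\<^sub>m m"
proof (induction m)
  case 0
  show ?case using assms by simp
next
  case (Suc m)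
  have "M ^\<^sub>m Suc (Suc m) = (M * M ^\<^sub>m m) * M" using Suc by simp
  also have "\<dots> = M * (M ^\<^sub>m m * M)"
    by (rule assoc_mult_mat[OF assms pow_carrier_mat[OF assms] assms])
  finally show ?case by simp
qed

lemma pow_mat_mult_pow_mat:
  assumes "M \<in> carrier_mat n n"
  shows "M ^\<^sub>m a * M ^\<^sub>m b = M ^\<^sub>m (a + b)"
proof (induction b)
  case 0
  show ?case using assms pow_carrier_mat[OF assms, of a] by simp
next
  case (Suc b)
  note P = pow_carrier_mat[OF assms]
  show ?case
    using Suc assoc_mult_mat[OF P P assms, of a b] by simp
qed

text \<open>
  The powers of the pencil $A + sB$ are the generating functions of the word sums.
\<close>

lemma pencil_power_entry:
  assumes A: "A \<in> carrier_mat n n" and B: "B \<in> carrier_mat n n"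
  shows "i < n \<Longrightarrow> j < n \<Longrightarrow>
    ((A + s \<cdot>\<^sub>m B) ^\<^sub>m m) $$ (i, j) = (\<Sum>k\<le>m. s ^ k * S_mat m k A B $$ (i, j))"
proof (induction m arbitrary: i j)
  case 0
  then show ?case using A B by (simp add: S_mat_0_0)
next
  case (Suc m)
  note ij = Suc.prems
  note S = S_mat_carrier[OF A]
  let ?M = "A + s \<cdot>\<^sub>m B"
  let ?a = "\<lambda>k. (A * S_mat m k A B) $$ (i, j)" and ?b = "\<lambda>k. (B * S_mat m k A B) $$ (i, j)"
  have M: "?M \<in> carrier_mat n n" using A B by simp
  have "(?M ^\<^sub>m Suc m) $$ (i, j) = (\<Sum>l<n. ?M $$ (i, l) * (?M ^\<^sub>m m) $$ (l, j))"
    unfolding pow_mat_Suc_left[OF M] by (rule mult_entry[OF M pow_carrier_mat[OF M] ij])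
  also have "\<dots> = (\<Sum>l<n. \<Sum>k\<le>m. s ^ k * (A $$ (i, l) * S_mat m k A B $$ (l, j)) +
      s ^ Suc k * (B $$ (i, l) * S_mat m k A B $$ (l, j)))"
    using A B ij by (intro sum.cong refl) (simp add: Suc.IH sum_distrib_left algebra_simps)
  also have "\<dots> = (\<Sum>k\<le>m. s ^ k * ?a k + s ^ Suc k * ?b k)"
    by (subst sum.swap)
       (simp add: mult_entry[OF A S ij] mult_entry[OF B S ij] sum.distrib sum_distrib_left mult.assoc
          del: index_mult_mat)
  also have "\<dots> = (\<Sum>k\<le>m. s ^ k * ?a k) + (\<Sum>k\<le>m. s ^ Suc k * ?b k)"
    by (rule sum.distrib)
  also have "(\<Sum>k\<le>m. s ^ k * ?a k) = (\<Sum>k\<le>Suc m. s ^ k * ?a k)"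
    using A ij by (simp add: S_mat_empty[OF A])
  also have "\<dots> = ?a 0 + (\<Sum>k\<le>m. s ^ Suc k * ?a (Suc k))"
    by (subst sum.atMost_Suc_shift) simp
  also have "?a 0 + (\<Sum>k\<le>m. s ^ Suc k * ?a (Suc k)) + (\<Sum>k\<le>m. s ^ Suc k * ?b k) =
      ?a 0 + (\<Sum>k\<le>m. s ^ Suc k * (?a (Suc k) + ?b k))"
    by (simp add: sum.distrib distrib_left)
  also have "\<dots> = S_mat (Suc m) 0 A B $$ (i, j) + (\<Sum>k\<le>m. s ^ Suc k * S_mat (Suc m) (Suc k) A B $$ (i, j))"
  proof -
    have "S_mat (Suc m) (Suc k) A B $$ (i, j) = ?a (Suc k) + ?b k" for k
      unfolding S_mat_Suc_Suc[OF A B] using A B S[of m k B] ij by (subst index_add_mat(1)) auto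
    then show ?thesis by (simp only: S_mat_Suc_0[OF A B])
  qed
  also have "\<dots> = (\<Sum>k\<le>Suc m. s ^ k * S_mat (Suc m) k A B $$ (i, j))"
    by (subst sum.atMost_Suc_shift) simp
  finally show ?case .
qed

lemma pencil_power_trace:
  assumes A: "A \<in> carrier_mat n n" and B: "B \<in> carrier_mat n n" and C: "C \<in> carrier_mat n n"
  shows "mat_trace ((A + s \<cdot>\<^sub>m B) ^\<^sub>m m * C) = (\<Sum>k\<le>m. s ^ k * mat_trace (S_mat m k A B * C))"
proof -
  have M: "A + s \<cdot>\<^sub>m B \<in> carrier_mat n n" using A B by simp
  have "mat_trace ((A + s \<cdot>\<^sub>m B) ^\<^sub>m m * C) =
      (\<Sum>i<n. \<Sum>j<n. \<Sum>k\<le>m. s ^ k * (S_mat m k A B $$ (i, j) * C $$ (j, i)))"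
    unfolding mat_trace_mult[OF pow_carrier_mat[OF M] C]
    by (intro sum.cong refl) (simp add: pencil_power_entry[OF A B] sum_distrib_right mult.assoc)
  also have "\<dots> = (\<Sum>i<n. \<Sum>k\<le>m. \<Sum>j<n. s ^ k * (S_mat m k A B $$ (i, j) * C $$ (j, i)))"
    by (intro sum.cong refl sum.swap)
  also have "\<dots> = (\<Sum>k\<le>m. \<Sum>i<n. \<Sum>j<n. s ^ k * (S_mat m k A B $$ (i, j) * C $$ (j, i)))"
    by (rule sum.swap)
  finally show ?thesis
    by (simp add: mat_trace_mult[OF S_mat_carrier[OF A] C] sum_distrib_left)
qed

text \<open>
  The derivative of $M^m$ is the sum of the products $M^i M' M^{m-1-i}$, and under the trace these are
  all equal by cyclicity. Tracing against an arbitrary power $M^l$ makes the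
  induction on $m$ go through: the summand that comes from the induction hypothesis is used with
  $l + 1$ in place of $l$. For $m = 0$ the truncated exponent is harmless because of the factor $m$.
\<close>

lemma matrix_power_derivative:
  fixes M :: "real \<Rightarrow> complex mat"
  assumes M: "\<And>t. M t \<in> carrier_mat n n" and M': "M' \<in> carrier_mat n n"
    and deriv: "\<And>i j. i < n \<Longrightarrow> j < n \<Longrightarrow>
      ((\<lambda>t. M t $$ (i, j)) has_vector_derivative M' $$ (i, j)) (at x)"
  shows "\<exists>D \<in> carrier_mat n n.
    (\<forall>i<n. \<forall>j<n. ((\<lambda>t. (M t ^\<^sub>m m) $$ (i, j)) has_vector_derivative D $$ (i, j)) (at x)) \<and>
    (\<forall>l. mat_trace (M x ^\<^sub>m l * D) = of_nat m * mat_trace (M x ^\<^sub>m (l + m - 1) * M'))"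
proof (induction m)
  case 0
  have "M t ^\<^sub>m 0 = 1\<^sub>m n" for t using M[of t] by simp
  then show ?case
    by (intro bexI[of _ "0\<^sub>m n n"])
       (auto simp: mat_trace_mult[OF pow_carrier_mat[OF M] zero_carrier_mat])
next
  case (Suc m)
  note P = pow_carrier_mat[OF M]
  from Suc obtain D where D: "D \<in> carrier_mat n n"
    and Dd: "\<And>i j. i < n \<Longrightarrow> j < n \<Longrightarrow>
      ((\<lambda>t. (M t ^\<^sub>m m) $$ (i, j)) has_vector_derivative D $$ (i, j)) (at x)"
    and Dt: "\<And>l. mat_trace (M x ^\<^sub>m l * D) = of_nat m * mat_trace (M x ^\<^sub>m (l + m - 1) * M')"
    by blast
  let ?D = "D * M x + M x ^\<^sub>m m * M'"
  note DM = mult_carrier_mat[OF D M[of x]] and MM = mult_carrier_mat[OF P[of x m] M']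
  have "((\<lambda>t. (M t ^\<^sub>m Suc m) $$ (i, j)) has_vector_derivative ?D $$ (i, j)) (at x)"
    if ij: "i < n" "j < n" for i j
  proof -
    have "(M t ^\<^sub>m Suc m) $$ (i, j) = (\<Sum>l<n. (M t ^\<^sub>m m) $$ (i, l) * M t $$ (l, j))" for t
      by (simp add: mult_entry[OF P M ij] del: index_mult_mat)
    moreover have "?D $$ (i, j) =
        (\<Sum>l<n. (M x ^\<^sub>m m) $$ (i, l) * M' $$ (l, j) + D $$ (i, l) * M x $$ (l, j))"
      using DM MM ij
      by (subst index_add_mat(1))
         (auto simp: mult_entry[OF P M' ij] mult_entry[OF D M ij] sum.distrib simp del: index_mult_mat(1))
    ultimately show ?thesis
      using ij by (simp only:) (intro has_vector_derivative_sum has_vector_derivative_mult Dd deriv; simp)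
  qed
  moreover have "mat_trace (M x ^\<^sub>m l * ?D) = of_nat (Suc m) * mat_trace (M x ^\<^sub>m (l + Suc m - 1) * M')" for l
  proof -
    have "M x ^\<^sub>m l * (D * M x) = (M x ^\<^sub>m l * D) * M x"
      by (rule assoc_mult_mat[OF P D M, symmetric])
    also have "mat_trace \<dots> = mat_trace (M x * (M x ^\<^sub>m l * D))"
      by (rule mat_trace_mult_commute[OF mult_carrier_mat[OF P D] M])
    also have "M x * (M x ^\<^sub>m l * D) = M x ^\<^sub>m Suc l * D"
      unfolding pow_mat_Suc_left[OF M] by (rule assoc_mult_mat[OF M P D, symmetric])
    also have "mat_trace \<dots> = of_nat m * mat_trace (M x ^\<^sub>m (l + m) * M')"
      by (subst Dt) simp
    finally have 1: "mat_trace (M x ^\<^sub>m l * (D * M x)) = of_nat m * mat_trace (M x ^\<^sub>m (l + m) * M')" .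
    have 2: "M x ^\<^sub>m l * (M x ^\<^sub>m m * M') = M x ^\<^sub>m (l + m) * M'"
      using assoc_mult_mat[OF P P M', of x l x m] by (simp add: pow_mat_mult_pow_mat[OF M])
    have "mat_trace (M x ^\<^sub>m l * ?D) =
        mat_trace (M x ^\<^sub>m l * (D * M x)) + mat_trace (M x ^\<^sub>m l * (M x ^\<^sub>m m * M'))"
      using P DM MM by (subst mult_add_distrib_mat[OF P DM MM]) (rule mat_trace_add[OF mult_carrier_mat[OF P DM] mult_carrier_mat[OF P MM]])
    then show ?thesis unfolding 1 2 by (simp add: algebra_simps)
  qed
  ultimately show ?case using DM MM by (intro bexI[of _ ?D]) auto
qed

text \<open>
  Both sides are coefficients of $s^{k+1}$ in the derivative of the trace of the $(m+1)$-st power of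
  the pencil $(A + tX) + s(B + tY)$ at $t = 0$.
\<close>

lemma word_sum_trace_derivative:
  assumes A: "A \<in> carrier_mat n n" and B: "B \<in> carrier_mat n n"
    and X: "X \<in> carrier_mat n n" and Y: "Y \<in> carrier_mat n n" and k: "k \<le> m"
  shows "((\<lambda>t. mat_trace (S_mat (Suc m) (Suc k) (A + complex_of_real t \<cdot>\<^sub>m X) (B + complex_of_real t \<cdot>\<^sub>m Y)))
     has_vector_derivative
       of_nat (Suc m) * (mat_trace (S_mat m (Suc k) A B * X) + mat_trace (S_mat m k A B * Y))) (at 0)"
proof -
  let ?A = "\<lambda>t. A + complex_of_real t \<cdot>\<^sub>m X" and ?B = "\<lambda>t. B + complex_of_real t \<cdot>\<^sub>m Y"
  let ?f = "\<lambda>q t. mat_trace (S_mat (Suc m) q (?A t) (?B t))"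
  have cA: "?A t \<in> carrier_mat n n" and cB: "?B t \<in> carrier_mat n n" for t using A B X Y by auto
  define d where "d q = vector_derivative (?f q) (at 0)" for q
  have entry: "((\<lambda>t. c + complex_of_real t * y) has_vector_derivative y) (at x)" for c y x
    by (auto intro!: derivative_eq_intros simp: has_vector_derivative_def scaleR_conv_of_real fun_eq_iff)
  have diff: "?f q differentiable (at 0)" for q
  proof -
    have "(\<lambda>t. word_eval (?A t) (?B t) w $$ (i, i)) differentiable (at 0)" if i: "i < n" for w i
    proof (rule word_eval_entry_closed[OF _ _ _ cA _ cB _ i i])
      fix i j assume "i < n" "j < n"
      then show "(\<lambda>t. ?A t $$ (i, j)) differentiable (at 0)" "(\<lambda>t. ?B t $$ (i, j)) differentiable (at 0)"
        using A B X Y differentiableI_vector[OF entry] by auto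
    qed auto
    then show ?thesis unfolding mat_trace_S_mat[OF cA]
      by (intro differentiable_sum ballI finite_words) auto
  qed
  have f_deriv: "(?f q has_vector_derivative d q) (at 0)" for q
    using diff[of q] unfolding d_def vector_derivative_works .
  define e where "e q = of_nat (Suc m) * (mat_trace (S_mat m q A B * X) +
     (case q of 0 \<Rightarrow> 0 | Suc p \<Rightarrow> mat_trace (S_mat m p A B * Y)))" for q
  \<comment> \<open>Here \<open>d\<close> lists the unknown derivatives and \<open>e\<close> their claimed values, for all numbers of
    letters \<open>B\<close> at once; they are compared as coefficients of polynomials in \<open>s\<close>.\<close>
  have "(\<Sum>q\<le>Suc m. d q * s ^ q) = (\<Sum>q\<le>Suc m. e q * s ^ q)" for s
  proof -
    let ?M = "\<lambda>t. ?A t + s \<cdot>\<^sub>m ?B t" and ?Z = "X + s \<cdot>\<^sub>m Y"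
    have cM: "?M t \<in> carrier_mat n n" for t using cA cB by simp
    have cZ: "?Z \<in> carrier_mat n n" using X Y by simp
    have M_deriv: "((\<lambda>t. ?M t $$ (i, j)) has_vector_derivative ?Z $$ (i, j)) (at 0)" if "i < n" "j < n" for i j
    proof -
      have "?M t $$ (i, j) = (A $$ (i, j) + s * B $$ (i, j)) + complex_of_real t * ?Z $$ (i, j)" for t
        using A B X Y that by (simp add: algebra_simps)
      then show ?thesis by (simp only: entry)
    qed
    obtain D where D: "D \<in> carrier_mat n n"
      and Dd: "\<And>i j. i < n \<Longrightarrow> j < n \<Longrightarrow>
        ((\<lambda>t. (?M t ^\<^sub>m Suc m) $$ (i, j)) has_vector_derivative D $$ (i, j)) (at 0)"
      and Dt: "\<And>l. mat_trace (?M 0 ^\<^sub>m l * D) =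
        of_nat (Suc m) * mat_trace (?M 0 ^\<^sub>m (l + Suc m - 1) * ?Z)"
      using matrix_power_derivative[OF cM cZ M_deriv, of "Suc m"] by blast
    have "((\<lambda>t. \<Sum>q\<le>Suc m. ?f q t * s ^ q) has_vector_derivative (\<Sum>q\<le>Suc m. d q * s ^ q)) (at 0)"
      by (intro has_vector_derivative_sum has_vector_derivative_mult_left f_deriv)
    moreover have "(\<Sum>q\<le>Suc m. ?f q t * s ^ q) = (\<Sum>i<n. (?M t ^\<^sub>m Suc m) $$ (i, i))" for t
    proof -
      have "(\<Sum>q\<le>Suc m. ?f q t * s ^ q) = (\<Sum>q\<le>Suc m. s ^ q * mat_trace (S_mat (Suc m) q (?A t) (?B t) * 1\<^sub>m n))"
        by (simp only: right_mult_one_mat[OF S_mat_carrier[OF cA]] mult.commute)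
      also have "\<dots> = mat_trace (?M t ^\<^sub>m Suc m * 1\<^sub>m n)"
        by (rule pencil_power_trace[OF cA cB one_carrier_mat, symmetric])
      finally show ?thesis
        by (simp only: right_mult_one_mat[OF pow_carrier_mat[OF cM]] mat_trace_carrier[OF pow_carrier_mat[OF cM]])
    qed
    moreover have "((\<lambda>t. \<Sum>i<n. (?M t ^\<^sub>m Suc m) $$ (i, i)) has_vector_derivative mat_trace D) (at 0)"
      unfolding mat_trace_carrier[OF D] by (intro has_vector_derivative_sum Dd) auto
    ultimately have "(\<Sum>q\<le>Suc m. d q * s ^ q) = mat_trace D"
      by (simp only: vector_derivative_unique_at)
    also have "mat_trace D = of_nat (Suc m) * mat_trace (?M 0 ^\<^sub>m m * ?Z)"
      using Dt[of 0] D X Y by simp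
    also have "?M 0 = A + s \<cdot>\<^sub>m B"
      using A B X Y by (intro eq_matI) auto
    also have "mat_trace ((A + s \<cdot>\<^sub>m B) ^\<^sub>m m * ?Z) =
        (\<Sum>q\<le>m. s ^ q * mat_trace (S_mat m q A B * X)) + (\<Sum>q\<le>m. s ^ Suc q * mat_trace (S_mat m q A B * Y))"
    proof -
      have S: "S_mat m q A B \<in> carrier_mat n n" for q by (rule S_mat_carrier[OF A])
      have "mat_trace (S_mat m q A B * ?Z) =
          mat_trace (S_mat m q A B * X) + s * mat_trace (S_mat m q A B * Y)" for q
        using S[of q] X Y
        by (simp add: mult_add_distrib_mat[of _ n n _ n] mult_smult_distrib[of _ n n _ n]
            mat_trace_add[of _ n] mat_trace_smult[of _ n])
      then show ?thesis
        unfolding pencil_power_trace[OF A B cZ] by (simp add: sum.distrib algebra_simps)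
    qed
    also have "(\<Sum>q\<le>m. s ^ q * mat_trace (S_mat m q A B * X)) = (\<Sum>q\<le>Suc m. s ^ q * mat_trace (S_mat m q A B * X))"
      using X by (simp add: S_mat_empty[OF A] mat_trace_def)
    also have "(\<Sum>q\<le>m. s ^ Suc q * mat_trace (S_mat m q A B * Y)) =
        (\<Sum>q\<le>Suc m. s ^ q * (case q of 0 \<Rightarrow> 0 | Suc p \<Rightarrow> mat_trace (S_mat m p A B * Y)))"
      by (subst sum.atMost_Suc_shift) simp
    also have "of_nat (Suc m) * ((\<Sum>q\<le>Suc m. s ^ q * mat_trace (S_mat m q A B * X)) + \<dots>) =
        (\<Sum>q\<le>Suc m. e q * s ^ q)"
      unfolding e_def sum.distrib[symmetric] sum_distrib_left
      by (intro sum.cong refl) (simp add: algebra_simps)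
    finally show ?thesis .
  qed
  then have "d (Suc k) = e (Suc k)"
    using polyfun_eq_coeffs[of d "Suc m" e] k by auto
  then show ?thesis using f_deriv[of "Suc k"] by (simp add: e_def)
qed

section \<open>A minimum over pairs of unit Hermitian matrices\<close>

text \<open>
  This is Tychonoff's theorem for a product of closed unit discs. It provides compactness for
  matrices whose dimension is a number and not a type.
\<close>

lemma compact_bounded_functions: "compact {f :: 'a \<Rightarrow> complex. \<forall>x. cmod (f x) \<le> 1}"
proof -
  have "compactin (product_topology (\<lambda>_. euclidean) UNIV) (\<Pi>\<^sub>E x\<in>(UNIV :: 'a set). cball (0::complex) 1)"
    unfolding compactin_PiE by simp
  moreover have "(\<Pi>\<^sub>E x\<in>(UNIV :: 'a set). cball (0::complex) 1) = {f. \<forall>x. cmod (f x) \<le> 1}"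
    by (auto simp: PiE_UNIV_domain)
  ultimately show ?thesis by (simp add: euclidean_product_topology)
qed

lemma trace_inner_smult_self:
  assumes "A \<in> carrier_mat n n"
  shows "trace_inner (complex_of_real r \<cdot>\<^sub>m A) (complex_of_real r \<cdot>\<^sub>m A) = r\<^sup>2 * trace_inner A A"
proof -
  have rA: "complex_of_real r \<cdot>\<^sub>m A \<in> carrier_mat n n" using assms by simp
  show ?thesis
    by (simp add: trace_inner_smult_right[OF rA assms] trace_inner_commute[OF rA assms]
        trace_inner_smult_right[OF assms assms] power2_eq_square)
qed

lemma trace_inner_one: "trace_inner (1\<^sub>m n) (1\<^sub>m n) = real n"
  by (simp add: trace_inner_def mat_trace_def)

lemma unit_hermitian_exists:
  assumes "A \<in> hermitian_mats n" "0 < trace_inner A A"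
  obtains A' where "A' \<in> hermitian_mats n" "trace_inner A' A' = 1"
    "A = complex_of_real (sqrt (trace_inner A A)) \<cdot>\<^sub>m A'"
proof
  let ?a = "sqrt (trace_inner A A)"
  let ?A' = "complex_of_real (1 / ?a) \<cdot>\<^sub>m A"
  note A = hermitian_mats_carrier[OF assms(1)]
  show "?A' \<in> hermitian_mats n" by (rule hermitian_mats_smult[OF assms(1)])
  show "trace_inner ?A' ?A' = 1"
    using assms(2) by (subst trace_inner_smult_self[OF A]) (simp add: power_divide)
  have "complex_of_real ?a * complex_of_real (1 / ?a) = 1"
    using assms(2) by (simp flip: of_real_mult)
  then show "A = complex_of_real ?a \<cdot>\<^sub>m ?A'"
    unfolding smult_smult_mat by (auto intro!: eq_matI)
qed

text \<open>
  A pair of matrices is read off from a single function on \<open>bool \<times> nat \<times> nat\<close>, whose first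
  argument selects the matrix. The functions that are bounded by $1$ and represent unit Hermitian
  pairs form a compact set, on which the trace is continuous.
\<close>

lemma word_sum_trace_minimum:
  assumes "n > 0"
  obtains A B where "A \<in> hermitian_mats n" "B \<in> hermitian_mats n"
    "trace_inner A A = 1" "trace_inner B B = 1"
    "\<And>A' B'. A' \<in> hermitian_mats n \<Longrightarrow> B' \<in> hermitian_mats n \<Longrightarrow>
       trace_inner A' A' = 1 \<Longrightarrow> trace_inner B' B' = 1 \<Longrightarrow>
       Re (mat_trace (S_mat m k A B)) \<le> Re (mat_trace (S_mat m k A' B'))"
proof -
  define M where "M b f = Matrix.mat n n (\<lambda>(i, j). f (b, i, j))"
    for b :: bool and f :: "bool \<times> nat \<times> nat \<Rightarrow> complex"
  define K where "K = {f :: bool \<times> nat \<times> nat \<Rightarrow> complex. \<forall>x. cmod (f x) \<le> 1} \<inter>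
    ({f. \<forall>b i j. f (b, i, j) = cnj (f (b, j, i))} \<inter>
     {f. \<forall>b. (\<Sum>i<n. \<Sum>j<n. (cmod (f (b, i, j)))\<^sup>2) = 1})"
  let ?F = "\<lambda>f. Re (mat_trace (S_mat m k (M True f) (M False f)))"
  have cM: "M b f \<in> carrier_mat n n" for b f by (simp add: M_def)
  have coord: "continuous_on UNIV (\<lambda>f :: bool \<times> nat \<times> nat \<Rightarrow> complex. f x)" for x
    by (rule continuous_on_product_coordinates)
  have "closed {f :: bool \<times> nat \<times> nat \<Rightarrow> complex. \<forall>b i j. f (b, i, j) = cnj (f (b, j, i))}"
    by (intro closed_Collect_all closed_Collect_eq continuous_on_cnj coord)
  moreover have "closed {f :: bool \<times> nat \<times> nat \<Rightarrow> complex. \<forall>b. (\<Sum>i<n. \<Sum>j<n. (cmod (f (b, i, j)))\<^sup>2) = 1}"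
    by (intro closed_Collect_all closed_Collect_eq continuous_on_sum continuous_on_power
        continuous_on_norm coord continuous_on_const)
  ultimately have compact: "compact K"
    unfolding K_def by (intro compact_Int_closed compact_bounded_functions closed_Int)
  have cont: "continuous_on K ?F"
  proof -
    have "continuous_on UNIV (\<lambda>f. word_eval (M True f) (M False f) w $$ (i, i))" if i: "i < n" for w i
    proof (rule word_eval_entry_closed[where P = "continuous_on UNIV", OF _ _ _ cM _ cM _ i i])
      fix i j assume "i < n" "j < n"
      then show "continuous_on UNIV (\<lambda>f. M True f $$ (i, j))" "continuous_on UNIV (\<lambda>f. M False f $$ (i, j))"
        by (simp_all add: M_def)
    qed (auto intro: continuous_intros)
    then have "continuous_on UNIV ?F"
      unfolding mat_trace_S_mat[OF cM] by (intro continuous_on_Re continuous_on_sum) auto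
    then show ?thesis by (rule continuous_on_subset) simp
  qed
  have K_unit: "M b f \<in> hermitian_mats n \<and> trace_inner (M b f) (M b f) = 1" if f: "f \<in> K" for b f
  proof -
    have "f (b, i, j) = cnj (f (b, j, i))" for i j using f unfolding K_def by blast
    then have "cnj (f (b, j, i)) = f (b, i, j)" for i j by (rule sym)
    then have h: "M b f \<in> hermitian_mats n" by (intro hermitian_matsI cM) (simp add: M_def)
    have "(\<Sum>i<n. \<Sum>j<n. (cmod (f (b, i, j)))\<^sup>2) = 1" using f unfolding K_def by blast
    then show ?thesis using h by (simp add: trace_inner_self[OF h]) (simp add: M_def)
  qed
  have unit_K: "\<exists>f \<in> K. M True f = A \<and> M False f = B"
    if AB: "A \<in> hermitian_mats n" "B \<in> hermitian_mats n" "trace_inner A A = 1" "trace_inner B B = 1" for A B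
  proof -
    define C where "C b = (if b then A else B)" for b
    have C: "C b \<in> hermitian_mats n" "(\<Sum>i<n. \<Sum>j<n. (cmod (C b $$ (i, j)))\<^sup>2) = 1" for b
      using AB by (simp_all add: C_def trace_inner_self)
    define f where "f = (\<lambda>(b, i, j). if i < n \<and> j < n then C b $$ (i, j) else 0)"
    have bound: "cmod (C b $$ (i, j)) \<le> 1" if ij: "i < n" "j < n" for b i j
    proof -
      have "(cmod (C b $$ (i, j)))\<^sup>2 \<le> (\<Sum>j<n. (cmod (C b $$ (i, j)))\<^sup>2)"
        using ij by (intro member_le_sum) auto
      also have "\<dots> \<le> (\<Sum>i<n. \<Sum>j<n. (cmod (C b $$ (i, j)))\<^sup>2)"
        using ij by (intro member_le_sum[of i _ "\<lambda>i. \<Sum>j<n. (cmod (C b $$ (i, j)))\<^sup>2"]) (auto intro: sum_nonneg)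
      finally show ?thesis using C(2)[of b] by (simp add: abs_square_le_1)
    qed
    have herm: "f (b, i, j) = cnj (f (b, j, i))" for b i j
      using hermitian_mats_entry[OF C(1), of i j b] by (auto simp: f_def)
    have "f \<in> K" unfolding K_def
    proof (intro IntI CollectI allI)
      show "cmod (f x) \<le> 1" for x using bound by (cases x) (auto simp: f_def)
      show "(\<Sum>i<n. \<Sum>j<n. (cmod (f (b, i, j)))\<^sup>2) = 1" for b
        using C(2)[of b] by (simp add: f_def)
    qed (rule herm)
    moreover have "M b f = C b" for b
      using hermitian_mats_carrier[OF C(1)[of b]] by (auto simp: M_def f_def intro!: eq_matI)
    ultimately show ?thesis by (intro bexI[of _ f]) (auto simp: C_def)
  qed
  obtain E where "E \<in> hermitian_mats n" "trace_inner E E = 1"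
    using unit_hermitian_exists[OF one_mat_hermitian[of n]] assms by (auto simp: trace_inner_one)
  with unit_K have "K \<noteq> {}" by blast
  then obtain f where f: "f \<in> K" "\<And>g. g \<in> K \<Longrightarrow> ?F f \<le> ?F g"
    using continuous_attains_inf[OF compact _ cont] by blast
  show ?thesis
  proof (rule that[of "M True f" "M False f"])
    fix A' B' assume "A' \<in> hermitian_mats n" "B' \<in> hermitian_mats n"
      "trace_inner A' A' = 1" "trace_inner B' B' = 1"
    then obtain g where "g \<in> K" "M True g = A'" "M False g = B'" using unit_K by blast
    then show "?F f \<le> Re (mat_trace (S_mat m k A' B'))" using f(2)[of g] by simp
  qed (use K_unit[OF f(1)] in auto)
qed

text \<open>
  Scaling to norm $1$ turns a lower bound on the unit spheres into one without a constraint. The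
  norms enter with the even exponents $m - k$ and $k$, so the bound is a polynomial in the squared
  norms and can be differentiated freely.
\<close>

lemma word_sum_trace_homogeneous_bound:
  assumes c: "\<And>A B. A \<in> hermitian_mats n \<Longrightarrow> B \<in> hermitian_mats n \<Longrightarrow>
       trace_inner A A = 1 \<Longrightarrow> trace_inner B B = 1 \<Longrightarrow> c \<le> Re (mat_trace (S_mat m k A B))"
    and pq: "m - k = 2 * p" "k = 2 * q"
    and A: "A \<in> hermitian_mats n" "0 < trace_inner A A"
    and B: "B \<in> hermitian_mats n" "0 < trace_inner B B"
  shows "c * trace_inner A A ^ p * trace_inner B B ^ q \<le> Re (mat_trace (S_mat m k A B))"
proof -
  let ?a = "sqrt (trace_inner A A)" and ?b = "sqrt (trace_inner B B)"
  obtain A' where A': "A' \<in> hermitian_mats n" "trace_inner A' A' = 1" "A = complex_of_real ?a \<cdot>\<^sub>m A'"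
    using unit_hermitian_exists[OF A] .
  obtain B' where B': "B' \<in> hermitian_mats n" "trace_inner B' B' = 1" "B = complex_of_real ?b \<cdot>\<^sub>m B'"
    using unit_hermitian_exists[OF B] .
  note cA' = hermitian_mats_carrier[OF A'(1)] and cB' = hermitian_mats_carrier[OF B'(1)]
  define r where "r = trace_inner A A ^ p * trace_inner B B ^ q"
  have "?a ^ (m - k) * ?b ^ k = r"
    using A(2) B(2) by (simp add: r_def pq(1)) (simp add: pq(2) power_mult)
  then have "complex_of_real ?a ^ (m - k) * complex_of_real ?b ^ k = complex_of_real r"
    by (simp flip: of_real_power of_real_mult)
  then have "S_mat m k A B = complex_of_real r \<cdot>\<^sub>m S_mat m k A' B'"
    by (subst A'(3), subst B'(3)) (simp add: S_mat_smult[OF cA' cB'])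
  then have "Re (mat_trace (S_mat m k A B)) = r * Re (mat_trace (S_mat m k A' B'))"
    by (simp add: mat_trace_smult[OF S_mat_carrier[OF cA']])
  moreover have "0 \<le> r" using A(2) B(2) by (simp add: r_def)
  ultimately show ?thesis
    using mult_left_mono[OF c[OF A'(1) B'(1) A'(2) B'(2)], of r]
    by (simp only: r_def mult.assoc mult.commute[of c])
qed

text \<open>
  The difference between the trace and its homogeneous lower bound is nonnegative near $(A,B)$ and
  vanishes at $(A,B)$, so its derivative in every Hermitian direction is $0$. This replaces Lagrange
  multipliers, and it yields the values of the multipliers as well.
\<close>

lemma word_sum_critical_point:
  assumes A: "A \<in> hermitian_mats n" "trace_inner A A = 1"
    and B: "B \<in> hermitian_mats n" "trace_inner B B = 1"
    and min: "\<And>A' B'. A' \<in> hermitian_mats n \<Longrightarrow> B' \<in> hermitian_mats n \<Longrightarrow>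
       trace_inner A' A' = 1 \<Longrightarrow> trace_inner B' B' = 1 \<Longrightarrow>
       Re (mat_trace (S_mat (Suc m) (Suc k) A B)) \<le> Re (mat_trace (S_mat (Suc m) (Suc k) A' B'))"
    and pq: "m - k = 2 * p" "Suc k = 2 * q" and k: "k \<le> m"
  defines "c \<equiv> Re (mat_trace (S_mat (Suc m) (Suc k) A B))"
  shows "S_mat m (Suc k) A B = complex_of_real (c * real (m - k) / real (Suc m)) \<cdot>\<^sub>m A"
    and "S_mat m k A B = complex_of_real (c * real (Suc k) / real (Suc m)) \<cdot>\<^sub>m B"
proof -
  note cA = hermitian_mats_carrier[OF A(1)] and cB = hermitian_mats_carrier[OF B(1)]
  define U where "U = S_mat m (Suc k) A B"
  define V where "V = S_mat m k A B"
  define \<alpha> where "\<alpha> = c * real (m - k) / real (Suc m)"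
  define \<beta> where "\<beta> = c * real (Suc k) / real (Suc m)"
  have hU: "U \<in> hermitian_mats n" and hV: "V \<in> hermitian_mats n"
    by (simp_all add: U_def V_def S_mat_hermitian A B)
  \<comment> \<open>The direction of differentiation is the defect in the two claimed equations. The derivative in
    this direction is a multiple of the sum of the squared norms of both defects.\<close>
  define X where "X = U + complex_of_real (- \<alpha>) \<cdot>\<^sub>m A"
  define Y where "Y = V + complex_of_real (- \<beta>) \<cdot>\<^sub>m B"
  have hX: "X \<in> hermitian_mats n" and hY: "Y \<in> hermitian_mats n"
    unfolding X_def Y_def by (intro hermitian_mats_add hermitian_mats_smult hU hV A B)+
  note cU = hermitian_mats_carrier[OF hU] and cV = hermitian_mats_carrier[OF hV]
    and cX = hermitian_mats_carrier[OF hX] and cY = hermitian_mats_carrier[OF hY]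
  let ?A = "\<lambda>t. A + complex_of_real t \<cdot>\<^sub>m X" and ?B = "\<lambda>t. B + complex_of_real t \<cdot>\<^sub>m Y"
  let ?NA = "\<lambda>t. trace_inner (?A t) (?A t)" and ?NB = "\<lambda>t. trace_inner (?B t) (?B t)"
  let ?T = "\<lambda>t. Re (mat_trace (S_mat (Suc m) (Suc k) (?A t) (?B t)))"
  define \<phi> where "\<phi> t = ?T t - c * ?NA t ^ p * ?NB t ^ q" for t
  have zero: "?A 0 = A" "?B 0 = B" using cA cB cX cY by (auto intro!: eq_matI)
  have NA: "(?NA has_real_derivative 2 * trace_inner A X) (at 0)"
    unfolding trace_inner_line[OF cA cX] by (auto intro!: derivative_eq_intros)
  have NB: "(?NB has_real_derivative 2 * trace_inner B Y) (at 0)"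
    unfolding trace_inner_line[OF cB cY] by (auto intro!: derivative_eq_intros)
  have NA0: "?NA 0 = 1" and NB0: "?NB 0 = 1" by (simp_all only: zero A B)
  have gen: "((\<lambda>t. T t - c * F t ^ p * G t ^ q) has_real_derivative T' - c * (real p * F' + real q * G')) (at 0)"
    if "(T has_real_derivative T') (at 0)" "(F has_real_derivative F') (at 0)"
      "(G has_real_derivative G') (at 0)" "F 0 = 1" "G 0 = 1" for T F G :: "real \<Rightarrow> real" and T' F' G'
    using that by (auto intro!: derivative_eq_intros simp: algebra_simps)
  have "(?T has_real_derivative real (Suc m) * (trace_inner U X + trace_inner V Y)) (at 0)"
    using bounded_linear.has_vector_derivative[OF bounded_linear_Re
        word_sum_trace_derivative[OF cA cB cX cY k]]
    by (simp add: has_real_derivative_iff_has_vector_derivative U_def V_def trace_inner_def)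
  then have "(\<phi> has_real_derivative (real (Suc m) * (trace_inner U X + trace_inner V Y)
      - c * (real p * (2 * trace_inner A X) + real q * (2 * trace_inner B Y)))) (at 0)"
    unfolding \<phi>_def by (rule gen[OF _ NA NB NA0 NB0])
  moreover have "\<forall>\<^sub>F t in nhds 0. \<phi> 0 \<le> \<phi> t"
  proof -
    have pos: "\<forall>\<^sub>F t in nhds 0. 0 < F t"
      if "(F has_real_derivative F') (at 0)" "F 0 = 1" for F :: "real \<Rightarrow> real" and F'
    proof -
      have "(F \<longlongrightarrow> F 0) (nhds 0)"
        using DERIV_isCont[OF that(1)] by (simp only: isCont_def tendsto_at_iff_tendsto_nhds)
      then show ?thesis by (rule order_tendstoD) (simp add: that(2))
    qed
    from pos[OF NA NA0] pos[OF NB NB0] show ?thesis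
    proof eventually_elim
      case (elim t)
      have "c * ?NA t ^ p * ?NB t ^ q \<le> ?T t"
        by (rule word_sum_trace_homogeneous_bound[OF _ _ pq(2) _ elim(1) _ elim(2)])
           (use min pq(1) in \<open>auto simp: c_def intro!: hermitian_mats_add hermitian_mats_smult A B hX hY\<close>)
      moreover have "\<phi> 0 = 0" by (simp only: \<phi>_def zero A B c_def) simp
      ultimately show ?case by (simp add: \<phi>_def)
    qed
  qed
  ultimately have "real (Suc m) * (trace_inner U X + trace_inner V Y)
      - c * (real p * (2 * trace_inner A X) + real q * (2 * trace_inner B Y)) = 0" (is "?d = 0")
  proof -
    assume deriv: "(\<phi> has_real_derivative ?d) (at 0)" and "\<forall>\<^sub>F t in nhds 0. \<phi> 0 \<le> \<phi> t"
    then obtain r where "0 < r" "\<And>t. dist t 0 < r \<Longrightarrow> \<phi> 0 \<le> \<phi> t"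
      unfolding eventually_nhds_metric by blast
    then show ?thesis by (intro DERIV_local_min[OF deriv, of r]) (auto simp: dist_real_def)
  qed
  moreover have "real p * 2 = real (m - k)" "real q * 2 = real (Suc k)"
    using arg_cong[OF pq(1), of real] arg_cong[OF pq(2), of real] by simp_all
  ultimately have "real (Suc m) * (trace_inner U X + trace_inner V Y) =
      c * (real (m - k) * trace_inner A X + real (Suc k) * trace_inner B Y)"
    by (simp only: mult.assoc[symmetric])
  moreover have "\<alpha> * trace_inner A X + \<beta> * trace_inner B Y =
      c * (real (m - k) * trace_inner A X + real (Suc k) * trace_inner B Y) / real (Suc m)"
    unfolding \<alpha>_def \<beta>_def by (simp only: add_divide_distrib distrib_left mult.assoc times_divide_eq_left)
  ultimately have crit: "\<alpha> * trace_inner A X + \<beta> * trace_inner B Y = trace_inner U X + trace_inner V Y"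
    by (metis nonzero_mult_div_cancel_left of_nat_0_eq_iff nat.distinct(1))
  have expand: "trace_inner Z Z = trace_inner P Z - r * trace_inner Q Z"
    if Z: "Z = P + complex_of_real (- r) \<cdot>\<^sub>m Q" and c: "P \<in> carrier_mat n n" "Q \<in> carrier_mat n n" for Z P Q r
  proof -
    have rQ: "complex_of_real (- r) \<cdot>\<^sub>m Q \<in> carrier_mat n n" using c by simp
    have cZ: "Z \<in> carrier_mat n n" using Z c by simp
    have "trace_inner Z Z = trace_inner Z (P + complex_of_real (- r) \<cdot>\<^sub>m Q)"
      by (rule arg_cong[OF Z])
    also have "\<dots> = trace_inner Z P + - r * trace_inner Z Q"
      by (simp only: trace_inner_add_right[OF cZ c(1) rQ] trace_inner_smult_right[OF cZ c(2)])
    finally show ?thesis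
      by (simp add: trace_inner_commute[OF cZ c(1)] trace_inner_commute[OF cZ c(2)])
  qed
  have "trace_inner X X = trace_inner U X - \<alpha> * trace_inner A X"
    "trace_inner Y Y = trace_inner V Y - \<beta> * trace_inner B Y"
    by (rule expand[OF X_def cU cA], rule expand[OF Y_def cV cB])
  then have "trace_inner X X = 0" "trace_inner Y Y = 0"
    using crit trace_inner_self_nonneg[OF hX] trace_inner_self_nonneg[OF hY] by linarith+
  then have XY: "X = 0\<^sub>m n n" "Y = 0\<^sub>m n n" using trace_inner_self_eq_0 hX hY by blast+
  have cancel: "P = complex_of_real r \<cdot>\<^sub>m Q"
    if "P + complex_of_real (- r) \<cdot>\<^sub>m Q = 0\<^sub>m n n" "P \<in> carrier_mat n n" "Q \<in> carrier_mat n n" for P Q r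
  proof (rule eq_matI)
    fix i j assume "i < dim_row (complex_of_real r \<cdot>\<^sub>m Q)" "j < dim_col (complex_of_real r \<cdot>\<^sub>m Q)"
    then show "P $$ (i, j) = (complex_of_real r \<cdot>\<^sub>m Q) $$ (i, j)"
      using that(2,3) arg_cong[OF that(1), of "\<lambda>Z. Z $$ (i, j)"] by simp
  qed (use that in auto)
  show "S_mat m (Suc k) A B = complex_of_real (c * real (m - k) / real (Suc m)) \<cdot>\<^sub>m A"
    using cancel[OF XY(1)[unfolded X_def] cU cA] unfolding U_def \<alpha>_def .
  show "S_mat m k A B = complex_of_real (c * real (Suc k) / real (Suc m)) \<cdot>\<^sub>m B"
    using cancel[OF XY(2)[unfolded Y_def] cV cB] unfolding V_def \<beta>_def .
qed

section \<open>Spectral facts for Hermitian matrices\<close>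

lemma hermitian_cscalar_prod:
  assumes A: "A \<in> hermitian_mats n" and v: "v \<in> carrier_vec n" and w: "w \<in> carrier_vec n"
  shows "(A *\<^sub>v v) \<bullet>c w = v \<bullet>c (A *\<^sub>v w)"
proof -
  note cA = hermitian_mats_carrier[OF A]
  have "(A *\<^sub>v v) \<bullet>c w = (\<Sum>i<n. \<Sum>j<n. A $$ (i, j) * v $ j * cnj (w $ i))"
    using cA v w by (simp add: scalar_prod_def atLeast0LessThan sum_distrib_right)
  also have "\<dots> = (\<Sum>j<n. \<Sum>i<n. A $$ (i, j) * v $ j * cnj (w $ i))"
    by (rule sum.swap)
  also have "\<dots> = (\<Sum>j<n. \<Sum>i<n. v $ j * cnj (A $$ (j, i) * w $ i))"
    by (intro sum.cong refl, subst hermitian_mats_entry[OF A]) (auto simp: mult_ac)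
  also have "\<dots> = v \<bullet>c (A *\<^sub>v w)"
    using cA v w by (simp add: scalar_prod_def atLeast0LessThan sum_distrib_left)
  finally show ?thesis .
qed

lemma eigenvector_cscalar_prod:
  fixes A :: "complex mat"
  assumes "A \<in> carrier_mat n n" "eigenvector A v e"
  shows "v \<in> carrier_vec n" "v \<bullet>c v > 0" "A *\<^sub>v v = e \<cdot>\<^sub>v v"
  using assms by (auto simp: eigenvector_def)

lemma hermitian_eigenvalue_real:
  assumes A: "A \<in> hermitian_mats n" and e: "eigenvalue A e"
  shows "e = complex_of_real (Re e)"
proof -
  obtain v where "eigenvector A v e" using e by (auto simp: eigenvalue_def)
  note v = eigenvector_cscalar_prod[OF hermitian_mats_carrier[OF A] this]
  have "e * (v \<bullet>c v) = cnj e * (v \<bullet>c v)"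
    using hermitian_cscalar_prod[OF A v(1) v(1)] v(1) by (simp add: v(3) conjugate_smult_vec)
  then have "e = cnj e" using v(2) by auto
  then show ?thesis by (simp add: complex_eq_iff)
qed

lemma mat_trace_similar:
  fixes A B :: "'a::comm_ring_1 mat"
  assumes "similar_mat_wit A B P Q"
  shows "mat_trace A = mat_trace B"
proof -
  define n where "n = dim_row A"
  have w: "A \<in> carrier_mat n n" "B \<in> carrier_mat n n" "P \<in> carrier_mat n n" "Q \<in> carrier_mat n n"
    "Q * P = 1\<^sub>m n" "A = P * B * Q"
    using similar_mat_witD[OF n_def assms] by auto
  have "mat_trace (P * B * Q) = mat_trace (Q * (P * B))"
    by (rule mat_trace_mult_commute[OF mult_carrier_mat[OF w(3,2)] w(4)])
  also have "Q * (P * B) = B"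
    using w by (subst assoc_mult_mat[OF w(4,3,2), symmetric]) simp
  finally show ?thesis using w(6) by simp
qed

text \<open>
  The eigenvalues of $S$ are the diagonal entries of an upper triangular matrix $T$ similar to $S$.
  They are nonpositive with nonnegative sum, hence all $0$. Then $T^2$ has trace $0$, so $S^2$
  does, and this trace is the squared Frobenius norm of $S$.
\<close>

lemma hermitian_nonpos_eigenvalues_trace:
  assumes S: "S \<in> hermitian_mats n"
    and nonpos: "\<And>r :: real. eigenvalue S (complex_of_real r) \<Longrightarrow> r \<le> 0"
    and trace: "0 \<le> Re (mat_trace S)"
  shows "S = 0\<^sub>m n n"
proof -
  note cS = hermitian_mats_carrier[OF S]
  obtain es where es: "char_poly S = (\<Prod>a\<leftarrow>es. [:- a, 1:])"
    using char_poly_factorized[OF cS] by blast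
  obtain T where T: "T \<in> carrier_mat n n" "upper_triangular T" "similar_mat S T"
    using schur_decomposition_exists[OF cS es] by blast
  then obtain P Q where wit: "similar_mat_wit S T P Q" by (auto simp: similar_mat_def)
  have diag: "T $$ (i, i) = complex_of_real (Re (T $$ (i, i)))" "Re (T $$ (i, i)) \<le> 0" if i: "i < n" for i
  proof -
    have "T $$ (i, i) \<in> set (diag_mat T)" using i T(1) by (auto simp: diag_mat_def)
    then have "poly (char_poly T) (T $$ (i, i)) = 0"
      by (subst char_poly_upper_triangular[OF T(1,2)]) (auto simp: poly_prod_list prod_list_zero_iff)
    then have ev: "eigenvalue S (T $$ (i, i))"
      by (simp add: eigenvalue_root_char_poly[OF cS] char_poly_similar[OF T(3)])
    show real: "T $$ (i, i) = complex_of_real (Re (T $$ (i, i)))"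
      by (rule hermitian_eigenvalue_real[OF S ev])
    then show "Re (T $$ (i, i)) \<le> 0" using nonpos ev by metis
  qed
  have "(\<Sum>i<n. - Re (T $$ (i, i))) \<le> 0"
    using trace by (simp add: mat_trace_similar[OF wit] mat_trace_carrier[OF T(1)] sum_negf)
  then have "(\<Sum>i<n. - Re (T $$ (i, i))) = 0"
    using diag(2) by (intro antisym sum_nonneg) auto
  then have "Re (T $$ (i, i)) = 0" if "i < n" for i
    using diag(2) that by (subst (asm) sum_nonneg_eq_0_iff) auto
  then have zero: "T $$ (i, i) = 0" if "i < n" for i
    using diag(1)[OF that] that by simp
  have "T $$ (i, j) * T $$ (j, i) = 0" if "i < n" "j < n" for i j
    using zero[OF that(1)] upper_triangularD[OF T(2), of i j] upper_triangularD[OF T(2), of j i] T(1) that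
    by (cases i j rule: linorder_cases) auto
  then have "mat_trace (T * T) = 0" 
    unfolding mat_trace_mult[OF T(1,1)] by (intro sum.neutral ballI) simp
  moreover have "mat_trace (S * S) = mat_trace (T * T)"
    using mat_trace_similar[OF similar_mat_wit_pow[OF wit, of 2]] cS T(1)
    by (simp add: numeral_2_eq_2)
  ultimately show ?thesis by (intro trace_inner_self_eq_0[OF S]) (simp add: trace_inner_def)
qed

text \<open>
  The quadratic form of the matrix at an eigenvector $v$ is
  $\alpha \|Av\|^2 + \beta \|Bv\|^2 \le 0$, and it equals $r \|v\|^2$.
\<close>

lemma nonpos_combination_of_squares_eigenvalue:
  assumes A: "A \<in> hermitian_mats n" and B: "B \<in> hermitian_mats n"
    and nonpos: "\<alpha> \<le> 0" "\<beta> \<le> 0"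
    and e: "eigenvalue (complex_of_real \<alpha> \<cdot>\<^sub>m (A * A) + complex_of_real \<beta> \<cdot>\<^sub>m (B * B)) (complex_of_real r)"
  shows "r \<le> 0"
proof -
  note cA = hermitian_mats_carrier[OF A] and cB = hermitian_mats_carrier[OF B]
  let ?S = "complex_of_real \<alpha> \<cdot>\<^sub>m (A * A) + complex_of_real \<beta> \<cdot>\<^sub>m (B * B)"
  have cS: "?S \<in> carrier_mat n n" using cA cB by simp
  obtain v where "eigenvector ?S v (complex_of_real r)" using e by (auto simp: eigenvalue_def)
  note v = eigenvector_cscalar_prod[OF cS this]
  have nonneg: "0 \<le> Re (w \<bullet>c w)" for w :: "complex Matrix.vec"
    using conjugate_square_ge_0_vec[of w] by (simp add: less_eq_complex_def)
  have square: "(M *\<^sub>v (M *\<^sub>v v)) \<bullet>c v = (M *\<^sub>v v) \<bullet>c (M *\<^sub>v v)" if "M \<in> hermitian_mats n" for M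
    using hermitian_cscalar_prod[OF that _ v(1), of "M *\<^sub>v v"] hermitian_mats_carrier[OF that] v(1)
    by simp
  have "complex_of_real r * (v \<bullet>c v) = (?S *\<^sub>v v) \<bullet>c v"
    using v(1) by (simp add: v(3))
  also have "?S *\<^sub>v v = complex_of_real \<alpha> \<cdot>\<^sub>v (A * A *\<^sub>v v) + complex_of_real \<beta> \<cdot>\<^sub>v (B * B *\<^sub>v v)"
  proof -
    have "(x \<cdot>\<^sub>m M) *\<^sub>v v = x \<cdot>\<^sub>v (M *\<^sub>v v)" if "M \<in> carrier_mat n n" for x :: complex and M
      using that v(1) by (intro eq_vecI) auto
    then show ?thesis
      using cA cB v(1) by (simp add: add_mult_distrib_mat_vec[of _ n n])
  qed
  also have "\<dots> \<bullet>c v = complex_of_real \<alpha> * ((A *\<^sub>v v) \<bullet>c (A *\<^sub>v v)) + complex_of_real \<beta> * ((B *\<^sub>v v) \<bullet>c (B *\<^sub>v v))"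
    using cA cB v(1) by (simp add: add_scalar_prod_distrib[of _ n] square[OF A] square[OF B])
  finally have "r * Re (v \<bullet>c v) = \<alpha> * Re ((A *\<^sub>v v) \<bullet>c (A *\<^sub>v v)) + \<beta> * Re ((B *\<^sub>v v) \<bullet>c (B *\<^sub>v v))"
    by (auto dest: arg_cong[of _ _ Re])
  also have "\<dots> \<le> 0"
    using nonpos nonneg by (intro add_nonpos_nonpos mult_nonpos_nonneg) auto
  finally show ?thesis using v(2) by (simp add: less_complex_def mult_le_0_iff)
qed

section \<open>The equivalence\<close>

text \<open>
  A minimising pair on the unit spheres has the required properties once the minimum is known to
  be negative. That follows by normalising the given pair, if both of its matrices are nonzero.
\<close>

lemma negative_trace_negative_semidefinite_word_sum:
  assumes n: "n > 0" and km: "k \<le> m" and pq: "m - k = 2 * p" "Suc k = 2 * q"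
    and A: "A \<in> hermitian_mats n" and B: "B \<in> hermitian_mats n"
    and neg: "Re (mat_trace (S_mat (Suc m) (Suc k) A B)) < 0"
  obtains A\<^sub>0 B\<^sub>0 where "A\<^sub>0 \<in> hermitian_mats n" "B\<^sub>0 \<in> hermitian_mats n"
    "S_mat (Suc m) (Suc k) A\<^sub>0 B\<^sub>0 \<noteq> 0\<^sub>m n n"
    "\<And>r :: real. eigenvalue (S_mat (Suc m) (Suc k) A\<^sub>0 B\<^sub>0) (complex_of_real r) \<Longrightarrow> r \<le> 0"
proof -
  let ?S = "S_mat (Suc m) (Suc k)"
  note cA = hermitian_mats_carrier[OF A] and cB = hermitian_mats_carrier[OF B]
  obtain A\<^sub>0 B\<^sub>0 where hA0: "A\<^sub>0 \<in> hermitian_mats n" and hB0: "B\<^sub>0 \<in> hermitian_mats n"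
    and NA0: "trace_inner A\<^sub>0 A\<^sub>0 = 1" and NB0: "trace_inner B\<^sub>0 B\<^sub>0 = 1"
    and min: "\<And>A' B'. A' \<in> hermitian_mats n \<Longrightarrow> B' \<in> hermitian_mats n \<Longrightarrow>
       trace_inner A' A' = 1 \<Longrightarrow> trace_inner B' B' = 1 \<Longrightarrow>
       Re (mat_trace (?S A\<^sub>0 B\<^sub>0)) \<le> Re (mat_trace (?S A' B'))"
    by (rule word_sum_trace_minimum[OF n, where m = "Suc m" and k = "Suc k"]) (rule that; blast)
  note A0 = hA0 NA0 and B0 = hB0 NB0
  note cA0 = hermitian_mats_carrier[OF A0(1)] and cB0 = hermitian_mats_carrier[OF B0(1)]
  define c where "c = Re (mat_trace (?S A\<^sub>0 B\<^sub>0))"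
  have trace_scaled: "mat_trace (?S (a \<cdot>\<^sub>m C) (b \<cdot>\<^sub>m D)) = a ^ (m - k) * b ^ Suc k * mat_trace (?S C D)"
    if "C \<in> carrier_mat n n" "D \<in> carrier_mat n n" for a b C D
    by (simp add: S_mat_smult[OF that] mat_trace_smult[OF S_mat_carrier[OF that(1)]])
  have c: "c < 0"
  proof -
    \<comment> \<open>The letter \<open>B\<close> occurs in every word, so \<open>B = 0\<close> would make the trace vanish.\<close>
    have "B \<noteq> 0\<^sub>m n n"
    proof
      assume "B = 0\<^sub>m n n"
      then have "B = 0 \<cdot>\<^sub>m B" by (auto intro!: eq_matI)
      moreover have "A = 1 \<cdot>\<^sub>m A" by (auto intro!: eq_matI)
      ultimately have "mat_trace (?S A B) = 0" using trace_scaled[OF cA cB, of 1 0] by simp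
      with neg show False by simp
    qed
    then have NB: "0 < trace_inner B B"
      using trace_inner_self_nonneg[OF B] trace_inner_self_eq_0[OF B] by fastforce
    \<comment> \<open>If \<open>A = 0\<close>, the trace can only be negative when no word contains the letter \<open>A\<close>; then
      \<open>A\<close> may be replaced by the identity matrix without changing the word sum.\<close>
    obtain A1 where A1: "A1 \<in> hermitian_mats n" "0 < trace_inner A1 A1"
      "Re (mat_trace (?S A1 B)) < 0"
    proof (cases "A = 0\<^sub>m n n")
      case False
      then have "0 < trace_inner A A"
        using trace_inner_self_nonneg[OF A] trace_inner_self_eq_0[OF A] by fastforce
      then show ?thesis using that A neg by blast
    next
      case True
      then have zero: "A = 0 \<cdot>\<^sub>m 1\<^sub>m n" by (auto intro!: eq_matI)
      have B1: "B = 1 \<cdot>\<^sub>m B" by (auto intro!: eq_matI)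
      have eq: "mat_trace (?S A B) = 0 ^ (m - k) * mat_trace (?S (1\<^sub>m n) B)"
        using trace_scaled[OF one_carrier_mat cB, of 0 1] unfolding zero[symmetric] B1[symmetric] by simp
      then have "m - k = 0" using neg by (cases "m - k") auto
      then have "Re (mat_trace (?S (1\<^sub>m n) B)) < 0" using eq neg by simp
      then show ?thesis using that[OF one_mat_hermitian] n by (simp add: trace_inner_one)
    qed
    have "c * trace_inner A1 A1 ^ p * trace_inner B B ^ q \<le> Re (mat_trace (?S A1 B))"
      by (rule word_sum_trace_homogeneous_bound[OF _ _ pq(2) A1(1,2) B NB])
         (use min pq(1) in \<open>auto simp: c_def\<close>)
    also note A1(3)
    finally have "c * (trace_inner A1 A1 ^ p * trace_inner B B ^ q) < 0" by (simp add: mult.assoc)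
    then show ?thesis using A1(2) NB by (simp add: mult_less_0_iff not_less)
  qed
  define \<alpha> where "\<alpha> = c * real (m - k) / real (Suc m)"
  define \<beta> where "\<beta> = c * real (Suc k) / real (Suc m)"
  have crit: "S_mat m (Suc k) A\<^sub>0 B\<^sub>0 = complex_of_real \<alpha> \<cdot>\<^sub>m A\<^sub>0"
    "S_mat m k A\<^sub>0 B\<^sub>0 = complex_of_real \<beta> \<cdot>\<^sub>m B\<^sub>0"
    unfolding \<alpha>_def \<beta>_def c_def
    using word_sum_critical_point[OF A0 B0 min pq km] by blast+
  have S0: "?S A\<^sub>0 B\<^sub>0 = complex_of_real \<alpha> \<cdot>\<^sub>m (A\<^sub>0 * A\<^sub>0) + complex_of_real \<beta> \<cdot>\<^sub>m (B\<^sub>0 * B\<^sub>0)"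
    unfolding S_mat_Suc_Suc[OF cA0 cB0] crit
    by (simp add: mult_smult_distrib[OF cA0 cA0] mult_smult_distrib[OF cB0 cB0])
  show ?thesis
  proof (rule that[OF A0(1) B0(1)])
    show "?S A\<^sub>0 B\<^sub>0 \<noteq> 0\<^sub>m n n" using c by (auto simp: c_def mat_trace_def)
    have "\<alpha> \<le> 0" "\<beta> \<le> 0" using c by (auto simp: \<alpha>_def \<beta>_def divide_nonpos_pos mult_nonpos_nonneg)
    then show "r \<le> 0" if "eigenvalue (?S A\<^sub>0 B\<^sub>0) (complex_of_real r)" for r
      using nonpos_combination_of_squares_eigenvalue[OF A0(1) B0(1)] that unfolding S0 by blast
  qed
qed

lemma hermitian_trace_real:
  assumes "S \<in> hermitian_mats n"
  shows "Im (mat_trace S) = 0"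
proof -
  have "Im (S $$ (i, i)) = 0" if "i < n" for i
    using hermitian_mats_entry[OF assms that that, symmetric]
    unfolding Reals_cnj_iff[symmetric] complex_is_Real_iff .
  then show ?thesis by (simp add: mat_trace_carrier[OF hermitian_mats_carrier[OF assms]])
qed

theorem theorem1p2:
  fixes n m k :: nat
  assumes "n > 0" and "m > 0" and "k > 0"
    and "even m" and "even k" and "k \<le> m"
  shows "(\<forall>A \<in> hermitian_mats n. \<forall>B \<in> hermitian_mats n. 0 \<le> mat_trace (S_mat m k A B))
     \<longleftrightarrow> (\<forall>A \<in> hermitian_mats n. \<forall>B \<in> hermitian_mats n.
           S_mat m k A B = 0\<^sub>m n n \<or>
           (\<exists>r::real. r > 0 \<and> eigenvalue (S_mat m k A B) (complex_of_real r)))"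
    (is "?trace \<longleftrightarrow> ?eigen")
proof
  assume ?trace
  show ?eigen
  proof (intro ballI disjCI)
    fix A B assume A: "A \<in> hermitian_mats n" and B: "B \<in> hermitian_mats n"
      and no: "\<not> (\<exists>r::real. r > 0 \<and> eigenvalue (S_mat m k A B) (complex_of_real r))"
    have "0 \<le> mat_trace (S_mat m k A B)" using \<open>?trace\<close> A B by blast
    then have "0 \<le> Re (mat_trace (S_mat m k A B))" by (simp add: less_eq_complex_def)
    then show "S_mat m k A B = 0\<^sub>m n n"
      using no by (intro hermitian_nonpos_eigenvalues_trace S_mat_hermitian A B) (auto simp: not_less)
  qed
next
  assume eigen: ?eigen
  obtain m' k' where mk: "m = Suc m'" "k = Suc k'" using assms(2,3) by (metis gr0_conv_Suc)
  have "even (m' - k')" using assms(4,5) mk by auto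
  then obtain p where p: "m' - k' = 2 * p" by (rule evenE)
  obtain q where q: "Suc k' = 2 * q" using assms(5) unfolding mk(2) by (rule evenE)
  have km: "k' \<le> m'" using assms(6) mk by simp
  show ?trace
  proof (intro ballI)
    fix A B assume A: "A \<in> hermitian_mats n" and B: "B \<in> hermitian_mats n"
    have "0 \<le> Re (mat_trace (S_mat m k A B))"
    proof (rule ccontr)
      assume "\<not> ?thesis"
      then have "Re (mat_trace (S_mat (Suc m') (Suc k') A B)) < 0" by (simp add: mk)
      then obtain A\<^sub>0 B\<^sub>0 where "A\<^sub>0 \<in> hermitian_mats n" "B\<^sub>0 \<in> hermitian_mats n"
        "S_mat m k A\<^sub>0 B\<^sub>0 \<noteq> 0\<^sub>m n n"
        "\<And>r :: real. eigenvalue (S_mat m k A\<^sub>0 B\<^sub>0) (complex_of_real r) \<Longrightarrow> r \<le> 0"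
        using negative_trace_negative_semidefinite_word_sum[OF assms(1) km p q A B] unfolding mk by blast
      then show False using eigen by (meson not_less)
    qed
    then show "0 \<le> mat_trace (S_mat m k A B)"
      using hermitian_trace_real[OF S_mat_hermitian[OF A B]] by (simp add: less_eq_complex_def)
  qed
qed

end
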